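(* For $n, m \in \mathbb{N}$, let $kr_2(n,m)$ be the number of partitions $\lambda_1 \le \lambda_2 \le \cdots \le \lambda_m$ of $n$ into $m$ parts with smallest part at least two, and difference at least three at distance two, such that if two successive parts differ by at most one, then their sum is divisible by three. Then $$\sum_{n, m \geq 0} kr_2(n, m)\, q^n x^m = \sum_{n_1, n_2 \geq 0} \frac{ q^{3n_2^2 + 3n_2 + n_1^2 + n_1 + 3n_1n_2}\, x^{2n_2 + n_1} }{ (q; q)_{n_1} (q^3; q^3)_{n_2} }.$$
   Context: $\mathbb{N}=\{0,1,2,\dots\}$. A partition of $n$ into $m$ parts is a non-decreasing sequence $\lambda_1 \le \cdots \le \lambda_m$ of positive integers with sum $n$ (the empty partition is the unique partition of $0$, with $m=0$; it satisfies all the conditions vacuously). "Difference at least $k$ at distance $d$" means $\lambda_{j+d}-\lambda_j \ge k$ for all $1 \le j \le m-d$. "Successive parts" are $\lambda_j$ and $\lambda_{j+1}$. The $q$-Pochhammer symbol is $(a;q)_n = \prod_{j=1}^{n}(1-aq^{j-1})$, with $(a;q)_0=1$. The identity is one of formal power series in $q$ and $x$. *)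

theory Defs
  imports "HOL-Analysis.Infinite_Sum" "HOL-Computational_Algebra.Formal_Power_Series"
begin

definition is_partition :: "nat \<Rightarrow> nat \<Rightarrow> nat list \<Rightarrow> bool" where
  "is_partition n m ls \<longleftrightarrow>
     length ls = m \<and> sorted ls \<and> (\<forall>p\<in>set ls. p > 0) \<and> sum_list ls = n"

text \<open>List positions start at 0. Differences are compared in additive form because
  subtraction on \<open>nat\<close> truncates.\<close>

definition diff_at_dist :: "nat \<Rightarrow> nat \<Rightarrow> nat list \<Rightarrow> bool" where
  "diff_at_dist k d ls \<longleftrightarrow> (\<forall>j. j + d < length ls \<longrightarrow> ls ! (j + d) \<ge> ls ! j + k)"

definition kr2 :: "nat \<Rightarrow> nat \<Rightarrow> nat" where
  "kr2 n m = card {ls. is_partition n m ls \<and> (\<forall>p\<in>set ls. p \<ge> 2) \<and> diff_at_dist 3 2 ls \<and>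
     (\<forall>j. Suc j < length ls \<longrightarrow> ls ! Suc j \<le> ls ! j + 1 \<longrightarrow> 3 dvd (ls ! j + ls ! Suc j))}"

definition qpochhammer :: "'a::comm_ring_1 \<Rightarrow> 'a \<Rightarrow> nat \<Rightarrow> 'a" where
  "qpochhammer a q n = (\<Prod>j=1..n. 1 - a * q ^ (j - 1))"

text \<open>
  Bivariate formal power series are modelled as \<open>rat fps fps\<close>: power series in the outer
  variable \<open>q\<close> whose coefficients are power series in the inner variable \<open>x\<close>.
  Infinite sums are taken with respect to the \<open>q\<close>-adic topology, the library topology
  on the outer type. It is finer than the topology of coefficientwise convergence, and every
  coefficient of a power of \<open>q\<close> receives only finitely many nonzero contributions
  in the sums considered here. Denominators built from \<open>qpochhammer\<close> have constant
  coefficient 1 as series in \<open>q\<close>, so dividing by them is multiplication by a genuine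
  inverse, although the coefficient ring \<open>rat fps\<close> is not a field.
\<close>

definition qvar :: "rat fps fps" where
  "qvar = fps_X"

definition xvar :: "rat fps fps" where
  "xvar = fps_const fps_X"

end

theory Submission
  imports Defs
begin

text \<open>
  Let a third variable \<open>t\<close> mark the number of parts. Write \<open>G\<^sub>i(t)\<close> for the generating function of the
  admissible partitions whose parts are all at least \<open>i\<close>. The admissibility conditions are invariant
  under adding 3 to every part, so that \<open>G\<^sub>i\<^sub>+\<^sub>3(t) = G\<^sub>i(q\<^sup>3 t)\<close>. Looking at the first parts, one finds
  that \<open>G\<^sub>1, G\<^sub>2, G\<^sub>3\<close> satisfy a linear system of \<open>q\<close>-difference equations
  (\<open>KR_system_list_gf\<close>):

  \<^item> \<open>G\<^sub>2 = G\<^sub>3 + t q\<^sup>2 G\<^sub>4\<close>, since after a part 2 the next part is at least 4;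

  \<^item> \<open>G\<^sub>3 = G\<^sub>4 + t q\<^sup>3 (G\<^sub>5 + t q\<^sup>3 G\<^sub>6)\<close>, since 3 may occur twice, but 3 and 4 not together;

  \<^item> \<open>G\<^sub>1 = G\<^sub>2 + t q (G\<^sub>4 + t q\<^sup>3 G\<^sub>5 + t q\<^sup>2 G\<^sub>4)\<close>, since after a part 1 the part 3 may occur
    only once, and the pair 1, 2 is allowed.

  On the analytic side, consider the family
  \<open>S(A, B) = \<Sum> q^(a\<^sup>2 + 3b\<^sup>2 + 3ab + Aa + Bb) t^(a + 2b) / ((q;q)\<^sub>a (q\<^sup>3;q\<^sup>3)\<^sub>b)\<close>.
  Cancelling the last factor of either Pochhammer symbol relates neighbouring members of the family
  (\<open>KR_series_contiguous_a\<close>, \<open>KR_series_contiguous_b\<close>), and the substitution of \<open>q\<^sup>3 t\<close> for \<open>t\<close> turns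
  \<open>S(A, B)\<close> into \<open>S(A + 3, B + 6)\<close>. These relations show that \<open>S(0, 0), S(1, 3), S(2, 3)\<close>
  solve the same system (\<open>KR_system_KR_series\<close>).

  The system determines its solution from the constant terms in \<open>t\<close>
  (\<open>KR_system_unique\<close>), because the only contribution of \<open>t^m\<close> to itself carries the factor
  \<open>q^(3m)\<close>, and \<open>1 - q^(3m)\<close> is not zero for \<open>m > 0\<close>. Hence \<open>G\<^sub>2 = S(1, 3)\<close>, and putting \<open>t = x\<close>
  gives the identity.
\<close>

unbundle fps_syntax

section \<open>Division by series with constant term one\<close>

text \<open>
  The coefficient ring \<open>rat fps\<close> is not a field, but a series with constant term 1 is a unit all the
  same, so the fractions below can be handled by clearing denominators.
\<close>

lemma divide_eq_iff_constant_term_one: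
  fixes f g h :: "rat fps fps"
  assumes "g $ 0 = 1"
  shows "f / g = h \<longleftrightarrow> f = h * g"
proof -
  have inv: "g * inverse g = 1"
    using fps_right_inverse[of g "inverse (g $ 0)"] assms by (simp add: fps_inverse_def[of g])
  have "f / g = f * inverse g"
    using assms by (simp add: fps_divide_unit)
  moreover have "f * inverse g * g = f" "h * g * inverse g = h"
    using inv by (simp_all add: mult.assoc mult.commute[of "inverse g"])
  ultimately show ?thesis by auto
qed

lemma qpochhammer_Suc: "qpochhammer a q (Suc n) = qpochhammer a q n * (1 - a * q ^ n)"
  by (simp add: qpochhammer_def)

lemma qpochhammer_constant_term:
  assumes "a $ 0 = 0"
  shows "qpochhammer a q n $ 0 = (1 :: rat fps)"
  using assms by (induction n) (simp_all add: qpochhammer_Suc, simp add: qpochhammer_def)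

section \<open>The double series and its contiguity relations\<close>

abbreviation q_denominator :: "nat \<Rightarrow> nat \<Rightarrow> rat fps fps" where
  "q_denominator a b \<equiv> qpochhammer qvar qvar a * qpochhammer (qvar ^ 3) (qvar ^ 3) b"

definition KR_term :: "nat \<Rightarrow> nat \<Rightarrow> nat \<Rightarrow> nat \<Rightarrow> rat fps fps" where
  "KR_term A B a b = qvar ^ (a^2 + 3 * b^2 + 3 * a * b + A * a + B * b) / q_denominator a b"

text \<open>The finitely many index pairs that contribute to \<open>t^m\<close>.\<close>

definition weight_fibre :: "nat \<Rightarrow> (nat \<times> nat) set" where
  "weight_fibre m = {(a, b). a + 2 * b = m}"

text \<open>
  The outermost variable \<open>fps_X\<close> is the marker \<open>t\<close> of the number of parts; the coefficients
  are series in \<open>q\<close>. Keeping \<open>t\<close> apart from \<open>x\<close>, and outermost, makes each coefficient a finite sum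
  and lets the substitution \<open>t \<mapsto> q\<^sup>3 t\<close> act on the coefficients one by one.
\<close>

definition KR_series :: "nat \<Rightarrow> nat \<Rightarrow> rat fps fps fps" where
  "KR_series A B = Abs_fps (\<lambda>m. \<Sum>(a, b)\<in>weight_fibre m. KR_term A B a b)"

abbreviation Q :: "rat fps fps fps" where
  "Q \<equiv> fps_const qvar"

abbreviation dilate :: "rat fps fps fps \<Rightarrow> rat fps fps fps" where
  "dilate f \<equiv> f oo (fps_const (qvar ^ 3) * fps_X)"

lemma finite_weight_fibre [simp]: "finite (weight_fibre m)"
  by (rule finite_subset[of _ "{..m} \<times> {..m}"]) (auto simp: weight_fibre_def)

lemma q_denominator_constant_term: "q_denominator a b $ 0 = 1"
  by (simp add: qpochhammer_constant_term qvar_def)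

lemma KR_term_eq_iff:
  "KR_term A B a b = h \<longleftrightarrow>
     qvar ^ (a^2 + 3 * b^2 + 3 * a * b + A * a + B * b) = h * q_denominator a b"
  unfolding KR_term_def by (rule divide_eq_iff_constant_term_one[OF q_denominator_constant_term])

lemma KR_term_mult_denominator:
  "KR_term A B a b * q_denominator a b = qvar ^ (a^2 + 3 * b^2 + 3 * a * b + A * a + B * b)"
  using KR_term_eq_iff by metis

lemma q_denominator_nonzero: "q_denominator a b \<noteq> 0"
  using q_denominator_constant_term[of a b] by (metis fps_zero_nth zero_neq_one)

lemma KR_term_shift:
  "KR_term (A + i) (B + j) a b = qvar ^ (i * a + j * b) * KR_term A B a b"
  unfolding KR_term_eq_iff mult.assoc KR_term_mult_denominator
  by (simp add: algebra_simps flip: power_add)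

text \<open>
  The factor \<open>1 - q^(a + 1)\<close> cancels the last factor of \<open>(q;q)\<^sub>a\<^sub>+\<^sub>1\<close>; expanding the quadratic form at
  \<open>a + 1\<close> then yields the linear terms \<open>2a + 3b\<close>, which are the increments of \<open>A\<close> and \<open>B\<close>.
\<close>

lemma KR_term_step_a:
  "KR_term A B (Suc a) b * (1 - qvar ^ Suc a) = qvar ^ (1 + A) * KR_term (A + 2) (B + 3) a b"
proof -
  have d: "q_denominator (Suc a) b = q_denominator a b * (1 - qvar ^ Suc a)"
    by (simp add: qpochhammer_Suc)
  have "KR_term A B (Suc a) b * (1 - qvar ^ Suc a) * q_denominator a b
      = qvar ^ (1 + A) * (KR_term (A + 2) (B + 3) a b * q_denominator a b)"
    using KR_term_mult_denominator[of A B "Suc a" b]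
    unfolding KR_term_mult_denominator d
    by (simp add: algebra_simps power2_eq_square flip: power_add)
  thus ?thesis
    using q_denominator_nonzero[of a b] by (simp only: mult.assoc[symmetric] mult_cancel_right) simp
qed

lemma KR_term_step_b:
  "KR_term A B a (Suc b) * (1 - qvar ^ (3 * Suc b))
     = qvar ^ (3 + B) * KR_term (A + 3) (B + 6) a b"
proof -
  have d: "q_denominator a (Suc b) = q_denominator a b * (1 - qvar ^ (3 * Suc b))"
    by (simp add: qpochhammer_Suc flip: power_mult power_add)
  have "KR_term A B a (Suc b) * (1 - qvar ^ (3 * Suc b)) * q_denominator a b
      = qvar ^ (3 + B) * (KR_term (A + 3) (B + 6) a b * q_denominator a b)"
    using KR_term_mult_denominator[of A B a "Suc b"]
    unfolding KR_term_mult_denominator d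
    by (simp add: algebra_simps power2_eq_square flip: power_add)
  thus ?thesis
    using q_denominator_nonzero[of a b] by (simp only: mult.assoc[symmetric] mult_cancel_right) simp
qed

text \<open>
  Raising \<open>A\<close> by 1 multiplies the summand at \<open>(a, b)\<close> by \<open>q^a\<close>. So the difference of the two series
  carries the factors \<open>1 - q^a\<close>, which remove the summands with \<open>a = 0\<close>; the others are shifted down
  by one in \<open>a\<close>.
\<close>

lemma KR_series_contiguous_a:
  "KR_series A B = KR_series (A + 1) B + Q ^ (1 + A) * fps_X * KR_series (A + 2) (B + 3)"
proof (rule fps_ext)
  fix m
  have "KR_series A B $ m - KR_series (A + 1) B $ m
      = (\<Sum>(a, b)\<in>weight_fibre m. KR_term A B a b * (1 - qvar ^ a))"
    using KR_term_shift[of A 1 B 0]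
    by (simp add: KR_series_def algebra_simps case_prod_beta flip: sum_subtractf)
  also have "\<dots> = (fps_X * (Q ^ (1 + A) * KR_series (A + 2) (B + 3))) $ m"
  proof (cases m)
    case 0
    thus ?thesis by (auto simp: weight_fibre_def intro!: sum.neutral)
  next
    case (Suc k)
    have "(\<Sum>(a, b)\<in>weight_fibre m. KR_term A B a b * (1 - qvar ^ a))
        = (\<Sum>(a, b)\<in>(\<lambda>(a, b). (Suc a, b)) ` weight_fibre k. KR_term A B a b * (1 - qvar ^ a))"
    proof (rule sum.mono_neutral_right)
      show "\<forall>i\<in>weight_fibre m - (\<lambda>(a, b). (Suc a, b)) ` weight_fibre k.
          (case i of (a, b) \<Rightarrow> KR_term A B a b * (1 - qvar ^ a)) = 0"
      proof safe
        fix a b assume "(a, b) \<in> weight_fibre m" "(a, b) \<notin> (\<lambda>(a, b). (Suc a, b)) ` weight_fibre k"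
        hence "a = 0" using Suc by (cases a) (auto simp: weight_fibre_def image_iff)
        thus "KR_term A B a b * (1 - qvar ^ a) = 0" by simp
      qed
      show "(\<lambda>(a, b). (Suc a, b)) ` weight_fibre k \<subseteq> weight_fibre m"
        using Suc by (auto simp: weight_fibre_def)
    qed simp
    also have "\<dots> = (\<Sum>(a, b)\<in>weight_fibre k. KR_term A B (Suc a) b * (1 - qvar ^ Suc a))"
      by (subst sum.reindex) (auto simp: inj_on_def case_prod_beta)
    also have "\<dots> = qvar ^ (1 + A) * KR_series (A + 2) (B + 3) $ k"
      unfolding KR_term_step_a by (simp add: KR_series_def sum_distrib_left case_prod_beta)
    finally show ?thesis using Suc by (simp add: fps_const_power del: power_Suc)
  qed
  finally show "KR_series A B $ m
      = (KR_series (A + 1) B + Q ^ (1 + A) * fps_X * KR_series (A + 2) (B + 3)) $ m"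
    by (simp add: algebra_simps)
qed

text \<open>
  The same argument in the other index: raising \<open>B\<close> by 3 produces \<open>q^(3b)\<close>, and a unit
  of \<open>b\<close> counts for two parts, whence \<open>t\<^sup>2\<close>.
\<close>

lemma KR_series_contiguous_b:
  "KR_series A B = KR_series A (B + 3) + Q ^ (3 + B) * fps_X ^ 2 * KR_series (A + 3) (B + 6)"
proof (rule fps_ext)
  fix m
  have "KR_series A B $ m - KR_series A (B + 3) $ m
      = (\<Sum>(a, b)\<in>weight_fibre m. KR_term A B a b * (1 - qvar ^ (3 * b)))"
    using KR_term_shift[of A 0 B 3]
    by (simp add: KR_series_def algebra_simps case_prod_beta flip: sum_subtractf)
  also have "\<dots> = (fps_X ^ 2 * (Q ^ (3 + B) * KR_series (A + 3) (B + 6))) $ m"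
  proof (cases "m < 2")
    case True
    have zero: "(\<Sum>(a, b)\<in>weight_fibre m. KR_term A B a b * (1 - qvar ^ (3 * b))) = 0"
    proof (rule sum.neutral, safe)
      fix a b assume "(a, b) \<in> weight_fibre m"
      hence "b = 0" using True by (simp add: weight_fibre_def)
      thus "KR_term A B a b * (1 - qvar ^ (3 * b)) = 0" by simp
    qed
    show ?thesis
      unfolding zero using True by (simp add: fps_X_power_mult_nth)
  next
    case False
    then obtain k where k: "m = k + 2" by (metis add.commute le_Suc_ex not_less)
    have "(\<Sum>(a, b)\<in>weight_fibre m. KR_term A B a b * (1 - qvar ^ (3 * b)))
        = (\<Sum>(a, b)\<in>(\<lambda>(a, b). (a, Suc b)) ` weight_fibre k. KR_term A B a b * (1 - qvar ^ (3 * b)))"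
    proof (rule sum.mono_neutral_right)
      show "\<forall>i\<in>weight_fibre m - (\<lambda>(a, b). (a, Suc b)) ` weight_fibre k.
          (case i of (a, b) \<Rightarrow> KR_term A B a b * (1 - qvar ^ (3 * b))) = 0"
      proof safe
        fix a b assume "(a, b) \<in> weight_fibre m" "(a, b) \<notin> (\<lambda>(a, b). (a, Suc b)) ` weight_fibre k"
        hence "b = 0" using k by (cases b) (auto simp: weight_fibre_def image_iff)
        thus "KR_term A B a b * (1 - qvar ^ (3 * b)) = 0" by simp
      qed
      show "(\<lambda>(a, b). (a, Suc b)) ` weight_fibre k \<subseteq> weight_fibre m"
        using k by (auto simp: weight_fibre_def)
    qed simp
    also have "\<dots> = (\<Sum>(a, b)\<in>weight_fibre k. KR_term A B a (Suc b) * (1 - qvar ^ (3 * Suc b)))"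
      by (subst sum.reindex) (auto simp: inj_on_def case_prod_beta)
    also have "\<dots> = qvar ^ (3 + B) * KR_series (A + 3) (B + 6) $ k"
      unfolding KR_term_step_b by (simp add: KR_series_def sum_distrib_left case_prod_beta)
    finally show ?thesis using k by (simp add: fps_const_power fps_X_power_mult_nth)
  qed
  finally show "KR_series A B $ m
      = (KR_series A (B + 3) + Q ^ (3 + B) * fps_X ^ 2 * KR_series (A + 3) (B + 6)) $ m"
    by (simp add: algebra_simps)
qed

text \<open>On \<open>t^(a + 2b)\<close> the substitution produces \<open>q^(3a + 6b)\<close>.\<close>

lemma dilate_KR_series: "dilate (KR_series A B) = KR_series (A + 3) (B + 6)"
proof (rule fps_ext)
  fix m
  have "KR_term (A + 3) (B + 6) a b = (qvar ^ 3) ^ m * KR_term A B a b"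
    if "(a, b) \<in> weight_fibre m" for a b
  proof -
    have "3 * a + 6 * b = 3 * m" using that by (auto simp: weight_fibre_def)
    thus ?thesis unfolding KR_term_shift by (simp flip: power_mult)
  qed
  thus "dilate (KR_series A B) $ m = KR_series (A + 3) (B + 6) $ m"
    unfolding fps_nth_compose_linear
    by (auto simp: KR_series_def sum_distrib_left case_prod_beta intro!: sum.cong)
qed

lemma KR_series_constant_term: "KR_series A B $ 0 = 1"
proof -
  have "weight_fibre 0 = {(0, 0)}" by (auto simp: weight_fibre_def)
  thus ?thesis by (simp add: KR_series_def KR_term_eq_iff qpochhammer_def)
qed

section \<open>A system of functional equations with a unique solution\<close>

text \<open>
  The equations for \<open>G\<^sub>1, G\<^sub>2, G\<^sub>3\<close> from the beginning, with \<open>G\<^sub>4, G\<^sub>5, G\<^sub>6\<close> written as the dilations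
  of \<open>G\<^sub>1, G\<^sub>2, G\<^sub>3\<close>.
\<close>

definition KR_system :: "rat fps fps fps \<Rightarrow> rat fps fps fps \<Rightarrow> rat fps fps fps \<Rightarrow> bool" where
  "KR_system F1 F2 F3 \<longleftrightarrow>
     F1 = F2 + Q * fps_X * (dilate F1 + Q ^ 3 * fps_X * dilate F2 + Q ^ 2 * fps_X * dilate F1) \<and>
     F2 = F3 + Q ^ 2 * fps_X * dilate F1 \<and>
     F3 = dilate F1 + Q ^ 3 * fps_X * (dilate F2 + Q ^ 3 * fps_X * dilate F3)"

text \<open>
  After dilation, every equation is a polynomial combination of contiguity relations. In the
  equation for \<open>S(2, 3)\<close> the two ways through \<open>S(7, 12)\<close> cancel; in the one for \<open>S(0, 0)\<close> those
  through \<open>S(5, 9)\<close> do.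
\<close>

lemma KR_system_KR_series: "KR_system (KR_series 0 0) (KR_series 1 3) (KR_series 2 3)"
proof -
  \<comment> \<open>Hiding the shape of \<open>Q\<close> keeps its powers from being merged under \<open>fps_const\<close>.\<close>
  obtain c where c: "Q = c" by blast
  have b33: "KR_series 3 3 = KR_series 3 6 + Q ^ 6 * fps_X ^ 2 * KR_series 6 9"
    using KR_series_contiguous_b[of 3 3] by simp
  have a23: "KR_series 2 3 = KR_series 3 3 + Q ^ 3 * fps_X * KR_series 4 6"
    using KR_series_contiguous_a[of 2 3] by (simp add: power3_eq_cube mult.assoc)
  have b46: "KR_series 4 6 = KR_series 4 9 + Q ^ 9 * fps_X ^ 2 * KR_series 7 12"
    using KR_series_contiguous_b[of 4 6] by simp
  have a59: "KR_series 5 9 = KR_series 6 9 + Q ^ 6 * fps_X * KR_series 7 12"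
    using KR_series_contiguous_a[of 5 9] by simp
  have a00: "KR_series 0 0 = KR_series 1 0 + Q * fps_X * KR_series 2 3"
    using KR_series_contiguous_a[of 0 0] by (simp add: numeral_2_eq_2)
  have b10: "KR_series 1 0 = KR_series 1 3 + Q ^ 3 * fps_X ^ 2 * KR_series 4 6"
    using KR_series_contiguous_b[of 1 0] by simp
  have a36: "KR_series 3 6 = KR_series 4 6 + Q ^ 4 * fps_X * KR_series 5 9"
    using KR_series_contiguous_a[of 3 6] by simp
  have F3: "KR_series 2 3 = KR_series 3 6
      + Q ^ 3 * fps_X * (KR_series 4 9 + Q ^ 3 * fps_X * KR_series 5 9)"
    unfolding a23 b33 b46 a59 c by (simp add: algebra_simps eval_nat_numeral)
  moreover have "KR_series 1 3 = KR_series 2 3 + Q ^ 2 * fps_X * KR_series 3 6"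
    using KR_series_contiguous_a[of 1 3] by (simp add: eval_nat_numeral)
  moreover have "KR_series 0 0 = KR_series 1 3 + Q * fps_X *
      (KR_series 3 6 + Q ^ 3 * fps_X * KR_series 4 9 + Q ^ 2 * fps_X * KR_series 3 6)"
    unfolding a00 b10 F3 a36 c by (simp add: algebra_simps eval_nat_numeral)
  ultimately show ?thesis
    unfolding KR_system_def dilate_KR_series by simp
qed

text \<open>
  By induction on \<open>m\<close>: if two solutions agree below \<open>t^m\<close>, then their coefficients of \<open>t^m\<close> differ in
  all three components by the same amount \<open>D\<close>, and the last equation gives \<open>D = q^(3m) D\<close>.
\<close>

lemma KR_system_unique:
  assumes F: "KR_system F1 F2 F3" and G: "KR_system G1 G2 G3"
    and const: "F1 $ 0 = G1 $ 0" "F2 $ 0 = G2 $ 0" "F3 $ 0 = G3 $ 0"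
  shows "F2 = G2"
proof -
  define same where "same m \<longleftrightarrow> F1 $ m = G1 $ m \<and> F2 $ m = G2 $ m \<and> F3 $ m = G3 $ m" for m
  have "same m" for m
  proof (induction m rule: less_induct)
    case (less m)
    show ?case
    proof (cases m)
      case 0
      thus ?thesis using const by (simp add: same_def)
    next
      case (Suc k)
      have IH: "F1 $ j = G1 $ j" "F2 $ j = G2 $ j" "F3 $ j = G3 $ j" if "j \<le> k" for j
        using less[of j] that Suc by (simp_all add: same_def)
      have coeffs: "H1 $ m = H2 $ m + qvar * ((qvar ^ 3) ^ k * H1 $ k +
            (if k = 0 then 0 else qvar ^ 3 * ((qvar ^ 3) ^ (k - 1) * H2 $ (k - 1)) +
               qvar ^ 2 * ((qvar ^ 3) ^ (k - 1) * H1 $ (k - 1))))"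
          "H2 $ m = H3 $ m + qvar ^ 2 * ((qvar ^ 3) ^ k * H1 $ k)"
          "H3 $ m = (qvar ^ 3) ^ m * H1 $ m + qvar ^ 3 * ((qvar ^ 3) ^ k * H2 $ k +
            (if k = 0 then 0 else qvar ^ 3 * ((qvar ^ 3) ^ (k - 1) * H3 $ (k - 1))))"
        if "KR_system H1 H2 H3" for H1 H2 H3
      proof -
        note eqs = that[unfolded KR_system_def fps_const_power mult.assoc]
        show "H1 $ m = H2 $ m + qvar * ((qvar ^ 3) ^ k * H1 $ k +
            (if k = 0 then 0 else qvar ^ 3 * ((qvar ^ 3) ^ (k - 1) * H2 $ (k - 1)) +
               qvar ^ 2 * ((qvar ^ 3) ^ (k - 1) * H1 $ (k - 1))))"
          by (subst eqs[THEN conjunct1]) (simp add: Suc del: power_Suc)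
        show "H2 $ m = H3 $ m + qvar ^ 2 * ((qvar ^ 3) ^ k * H1 $ k)"
          by (subst eqs[THEN conjunct2, THEN conjunct1]) (simp add: Suc del: power_Suc)
        show "H3 $ m = (qvar ^ 3) ^ m * H1 $ m + qvar ^ 3 * ((qvar ^ 3) ^ k * H2 $ k +
            (if k = 0 then 0 else qvar ^ 3 * ((qvar ^ 3) ^ (k - 1) * H3 $ (k - 1))))"
          by (subst eqs[THEN conjunct2, THEN conjunct2]) (simp add: Suc del: power_Suc)
      qed
      \<comment> \<open>The lower coefficients agree, so they cancel from the differences.\<close>
      have d1: "F1 $ m - G1 $ m = F2 $ m - G2 $ m"
        unfolding coeffs(1)[OF F] coeffs(1)[OF G] by (simp add: IH)
      have d2: "F2 $ m - G2 $ m = F3 $ m - G3 $ m"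
        unfolding coeffs(2)[OF F] coeffs(2)[OF G] by (simp add: IH)
      have d3: "F3 $ m - G3 $ m = (qvar ^ 3) ^ m * (F1 $ m - G1 $ m)"
        unfolding coeffs(3)[OF F] coeffs(3)[OF G] by (simp add: IH algebra_simps)
      have "(1 - (qvar ^ 3) ^ m) * (F1 $ m - G1 $ m) = 0"
        using d1 d2 d3 by (simp add: algebra_simps)
      moreover have "((1 - (qvar ^ 3) ^ m) :: rat fps fps) $ 0 = 1"
        using Suc by (simp add: qvar_def)
      hence "1 - (qvar ^ 3) ^ m \<noteq> (0 :: rat fps fps)"
        by (metis fps_zero_nth zero_neq_one)
      ultimately have "F1 $ m - G1 $ m = 0"
        by (metis mult_eq_0_iff)
      thus ?thesis
        using d1 d2 by (simp add: same_def)
    qed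
  qed
  thus ?thesis by (simp add: same_def fps_eq_iff)
qed

section \<open>Generating functions of sets of lists\<close>

text \<open>
  \<open>t\<close> marks the length and \<open>q\<close> the sum; the coefficients are constant as series in \<open>x\<close>.
\<close>

definition list_gf :: "nat list set \<Rightarrow> rat fps fps fps" where
  "list_gf X = Abs_fps (\<lambda>m. Abs_fps (\<lambda>n. of_nat (card {ls \<in> X. length ls = m \<and> sum_list ls = n})))"

lemma list_gf_nth: "list_gf X $ m $ n = of_nat (card {ls \<in> X. length ls = m \<and> sum_list ls = n})"
  by (simp add: list_gf_def)

lemma finite_lists_length_sum: "finite {ls \<in> X. length ls = m \<and> sum_list ls = (n::nat)}"
  by (rule finite_subset[OF _ finite_lists_length_eq[of "{..n}" m]])
    (auto dest: member_le_sum_list)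

lemma list_gf_Un:
  assumes "X \<inter> Y = {}"
  shows "list_gf (X \<union> Y) = list_gf X + list_gf Y"
proof (rule fps_ext, rule fps_ext)
  fix m n
  have "{ls \<in> X \<union> Y. length ls = m \<and> sum_list ls = n} =
      {ls \<in> X. length ls = m \<and> sum_list ls = n} \<union> {ls \<in> Y. length ls = m \<and> sum_list ls = n}"
    by auto
  thus "list_gf (X \<union> Y) $ m $ n = (list_gf X + list_gf Y) $ m $ n"
    using assms
    by (simp add: list_gf_nth card_Un_disjoint finite_lists_length_sum disjoint_iff)
qed

lemma list_gf_Cons: "list_gf ((#) p ` X) = Q ^ p * fps_X * list_gf X"
proof (rule fps_ext, rule fps_ext)
  fix m n
  show "list_gf ((#) p ` X) $ m $ n = (Q ^ p * fps_X * list_gf X) $ m $ n"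
  proof (cases "m = 0 \<or> n < p")
    case True
    hence empty: "{ls \<in> (#) p ` X. length ls = m \<and> sum_list ls = n} = {}" by auto
    show ?thesis using True
      by (auto simp: list_gf_nth empty mult.assoc qvar_def fps_X_power_mult_nth)
  next
    case False
    then obtain k where k: "m = Suc k" by (cases m) auto
    have "{ls \<in> (#) p ` X. length ls = m \<and> sum_list ls = n}
        = (#) p ` {ls \<in> X. length ls = k \<and> sum_list ls = n - p}"
      using False k by auto
    hence "card {ls \<in> (#) p ` X. length ls = m \<and> sum_list ls = n}
        = card {ls \<in> X. length ls = k \<and> sum_list ls = n - p}"
      by (simp add: card_image)
    thus ?thesis using False k
      by (simp add: list_gf_nth mult.assoc qvar_def fps_X_power_mult_nth)
  qed
qed

lemma sum_list_map_add: "sum_list (map ((+) k) ls) = k * length ls + sum_list (ls :: nat list)"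
  by (induction ls) auto

lemma list_gf_map_add: "list_gf (map ((+) 3) ` X) = dilate (list_gf X)"
proof (rule fps_ext, rule fps_ext)
  fix m n
  show "list_gf (map ((+) 3) ` X) $ m $ n = dilate (list_gf X) $ m $ n"
  proof (cases "n < 3 * m")
    case True
    hence empty: "{ls \<in> map ((+) 3) ` X. length ls = m \<and> sum_list ls = n} = {}"
      by (auto simp: sum_list_map_add)
    show ?thesis using True
      by (simp add: list_gf_nth empty qvar_def fps_X_power_mult_nth flip: power_mult)
  next
    case False
    hence "{ls \<in> map ((+) 3) ` X. length ls = m \<and> sum_list ls = n}
        = map ((+) 3) ` {ls \<in> X. length ls = m \<and> sum_list ls = n - 3 * m}"
      by (auto simp: sum_list_map_add)
    moreover have "inj_on (map ((+) (3::nat))) Y" for Y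
      using inj_on_subset[of "map ((+) (3::nat))" UNIV Y] by simp
    ultimately have "card {ls \<in> map ((+) 3) ` X. length ls = m \<and> sum_list ls = n}
        = card {ls \<in> X. length ls = m \<and> sum_list ls = n - 3 * m}"
      by (simp add: card_image)
    thus ?thesis using False
      by (simp add: list_gf_nth qvar_def fps_X_power_mult_nth flip: power_mult)
  qed
qed

section \<open>Recursive structure of the partitions\<close>

text \<open>
  The conditions on a partition other than the bound on its smallest part. They are
  unchanged when 3 is added to all parts.
\<close>

definition KR_list :: "nat list \<Rightarrow> bool" where
  "KR_list ls \<longleftrightarrow> sorted ls \<and> diff_at_dist 3 2 ls \<and>
     (\<forall>j. Suc j < length ls \<longrightarrow> ls ! Suc j \<le> ls ! j + 1 \<longrightarrow> 3 dvd (ls ! j + ls ! Suc j))"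

definition KR :: "nat \<Rightarrow> nat list set" where
  "KR i = {ls. KR_list ls \<and> (\<forall>p\<in>set ls. i \<le> p)}"

lemma all_nat_Suc_iff: "(\<forall>j. P j) \<longleftrightarrow> P 0 \<and> (\<forall>j. P (Suc j))"
  using nat.exhaust by metis

lemma KR_list_simps [simp]:
  "KR_list []"
  "KR_list [x]"
  "KR_list [x, y] \<longleftrightarrow> x \<le> y \<and> (y \<le> x + 1 \<longrightarrow> 3 dvd x + y)"
  "KR_list (x # y # z # ls) \<longleftrightarrow>
     x \<le> y \<and> (y \<le> x + 1 \<longrightarrow> 3 dvd x + y) \<and> x + 3 \<le> z \<and> KR_list (y # z # ls)"
proof -
  show "KR_list (x # y # z # ls) \<longleftrightarrow>
     x \<le> y \<and> (y \<le> x + 1 \<longrightarrow> 3 dvd x + y) \<and> x + 3 \<le> z \<and> KR_list (y # z # ls)"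
    unfolding KR_list_def diff_at_dist_def
      all_nat_Suc_iff[of "\<lambda>j. j + 2 < length (x # y # z # ls) \<longrightarrow> _ j"]
      all_nat_Suc_iff[of "\<lambda>j. Suc j < length (x # y # z # ls) \<longrightarrow> _ j"]
    by auto
qed (auto simp: KR_list_def diff_at_dist_def)

lemma KR_list_sorted: "KR_list ls \<Longrightarrow> sorted ls"
  by (simp add: KR_list_def)

lemma Nil_in_KR [simp]: "[] \<in> KR i"
  by (simp add: KR_def)

lemma Cons_in_KR [simp]: "x # ls \<in> KR i \<longleftrightarrow> i \<le> x \<and> KR_list (x # ls)"
proof -
  have "\<forall>p\<in>set ls. x \<le> p" if "KR_list (x # ls)"
    using KR_list_sorted[OF that] by simp
  thus ?thesis
    by (auto simp: KR_def intro: le_trans[of i x])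
qed

lemma KR_split_least: "KR i = KR (Suc i) \<union> (#) i ` {ls. i # ls \<in> KR i}"
proof (rule set_eqI)
  fix ls
  show "ls \<in> KR i \<longleftrightarrow> ls \<in> KR (Suc i) \<union> (#) i ` {ls. i # ls \<in> KR i}"
    by (cases ls) (auto simp: image_iff Suc_le_eq le_less)
qed

text \<open>
  The distance condition looks two positions ahead, so three leading parts decide whether a new
  first part may be added.
\<close>

lemma list_cases_upto3:
  assumes "P []" "\<And>x. P [x]" "\<And>x y. P [x, y]" "\<And>x y z zs. P (x # y # z # zs)"
  shows "P ls"
  using assms by (metis list.exhaust)

lemma KR_list_first_two: "KR_list (x # y # ls) \<Longrightarrow> x \<le> y \<and> (y \<le> x + 1 \<longrightarrow> 3 dvd x + y)"
  by (cases ls) auto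

text \<open>
  The next three lemmas are finite inspections modulo 3. A part \<open>p\<close> may be followed by \<open>p\<close> only if
  3 divides \<open>p\<close>, and by \<open>p + 1\<close> only if \<open>p\<close> is 1 modulo 3. The distance condition adds nothing beyond
  this when the next part is already at least \<open>p + 2\<close>, except that 1, 3, 3 is excluded.
\<close>

lemma tails_after_2: "{ls. 2 # ls \<in> KR 2} = KR 4"
proof (rule set_eqI)
  fix ls
  show "ls \<in> {ls. 2 # ls \<in> KR 2} \<longleftrightarrow> ls \<in> KR 4"
    by (induction ls rule: list_cases_upto3; auto; (frule KR_list_first_two)?; presburger)
qed

lemma tails_after_3: "{ls. 3 # ls \<in> KR 3} = KR 5 \<union> (#) 3 ` KR 6"
proof (rule set_eqI)
  fix ls
  show "ls \<in> {ls. 3 # ls \<in> KR 3} \<longleftrightarrow> ls \<in> KR 5 \<union> (#) 3 ` KR 6"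
    by (induction ls rule: list_cases_upto3; auto simp: image_iff;
        (frule KR_list_first_two)?; presburger)
qed

lemma tails_after_1: "{ls. 1 # ls \<in> KR 1} = KR 4 \<union> (#) 3 ` KR 5 \<union> (#) 2 ` KR 4"
proof (rule set_eqI)
  fix ls
  show "ls \<in> {ls. 1 # ls \<in> KR 1} \<longleftrightarrow> ls \<in> KR 4 \<union> (#) 3 ` KR 5 \<union> (#) 2 ` KR 4"
    by (induction ls rule: list_cases_upto3; auto simp: image_iff;
        (frule KR_list_first_two)?; presburger)
qed

lemma KR_list_map_add: "KR_list (map ((+) 3) ls) \<longleftrightarrow> KR_list ls"
proof (induction ls)
  case (Cons x ls)
  have "3 dvd (x + 3) + (y + 3) \<longleftrightarrow> 3 dvd x + y" for y by presburger
  thus ?case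
    using Cons.IH by (induction ls rule: list_cases_upto3) (auto simp: add.commute)
qed simp

lemma KR_shift: "KR (i + 3) = map ((+) 3) ` KR i"
proof (intro set_eqI iffI)
  fix ls assume ls: "ls \<in> KR (i + 3)"
  have "map ((+) 3) (map (\<lambda>p. p - 3) ls) = map id ls"
    unfolding map_map by (rule map_cong) (use ls in \<open>auto simp: KR_def\<close>)
  hence eq: "ls = map ((+) 3) (map (\<lambda>p. p - 3) ls)" by simp
  moreover have "map (\<lambda>p. p - 3) ls \<in> KR i"
    using ls KR_list_map_add[of "map (\<lambda>p. p - 3) ls", folded eq] by (auto simp: KR_def)
  ultimately show "ls \<in> map ((+) 3) ` KR i" by blast
qed (auto simp: KR_def KR_list_map_add)

lemma list_gf_KR_shift: "list_gf (KR (i + 3)) = dilate (list_gf (KR i))"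
  by (simp add: KR_shift list_gf_map_add)

lemma KR_system_list_gf: "KR_system (list_gf (KR 1)) (list_gf (KR 2)) (list_gf (KR 3))"
proof -
  have split: "list_gf (KR i)
      = list_gf (KR (Suc i)) + Q ^ i * fps_X * list_gf {ls. i # ls \<in> KR i}" for i
  proof -
    have "KR (Suc i) \<inter> (#) i ` {ls. i # ls \<in> KR i} = {}" by auto
    thus ?thesis by (subst KR_split_least) (simp only: list_gf_Un list_gf_Cons)
  qed
  have gf3: "list_gf {ls. 3 # ls \<in> KR 3} = list_gf (KR 5) + Q ^ 3 * fps_X * list_gf (KR 6)"
    unfolding tails_after_3 by (subst list_gf_Un) (auto simp: list_gf_Cons)
  have gf1: "list_gf {ls. 1 # ls \<in> KR 1}
      = list_gf (KR 4) + Q ^ 3 * fps_X * list_gf (KR 5) + Q ^ 2 * fps_X * list_gf (KR 4)"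
    unfolding tails_after_1 by (subst list_gf_Un, force, subst list_gf_Un) (auto simp: list_gf_Cons)
  have shift: "list_gf (KR 4) = dilate (list_gf (KR 1))" "list_gf (KR 5) = dilate (list_gf (KR 2))"
      "list_gf (KR 6) = dilate (list_gf (KR 3))"
    using list_gf_KR_shift[of 1] list_gf_KR_shift[of 2] list_gf_KR_shift[of 3] by simp_all
  show ?thesis
    unfolding KR_system_def shift[symmetric]
    using split[of 1] split[of 2] split[of 3] gf1 gf3 tails_after_2
    by (simp add: eval_nat_numeral)
qed

lemma list_gf_KR_constant_term: "list_gf (KR i) $ 0 = 1"
proof (rule fps_ext)
  fix n
  have "{ls \<in> KR i. length ls = 0 \<and> sum_list ls = n} = (if n = 0 then {[]} else {})"
    by auto
  thus "list_gf (KR i) $ 0 $ n = 1 $ n"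
    by (simp add: list_gf_nth)
qed

lemma list_gf_KR2: "list_gf (KR 2) = KR_series 1 3"
  by (rule KR_system_unique[OF KR_system_list_gf KR_system_KR_series])
    (simp_all add: list_gf_KR_constant_term KR_series_constant_term)

section \<open>Summation over both indices\<close>

lemma kr2_eq_coefficient: "of_nat (kr2 n m) = list_gf (KR 2) $ m $ n"
proof -
  have "{ls. is_partition n m ls \<and> (\<forall>p\<in>set ls. p \<ge> 2) \<and> diff_at_dist 3 2 ls \<and>
     (\<forall>j. Suc j < length ls \<longrightarrow> ls ! Suc j \<le> ls ! j + 1 \<longrightarrow> 3 dvd (ls ! j + ls ! Suc j))}
     = {ls \<in> KR 2. length ls = m \<and> sum_list ls = n}"
    by (force simp: is_partition_def KR_def KR_list_def)
  thus ?thesis by (simp add: kr2_def list_gf_nth)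
qed

lemma has_sum_fps_finite_support:
  fixes F :: "'i \<Rightarrow> 'a :: ab_group_add fps"
  assumes "\<And>n. finite (I n)"
    and "\<And>n i. i \<notin> I n \<Longrightarrow> F i $ n = 0"
    and "\<And>n. S $ n = (\<Sum>i\<in>I n. F i $ n)"
  shows "(F has_sum S) UNIV"
proof (rule has_sum_fpsI)
  fix n
  have sub: "{i \<in> UNIV. F i $ n \<noteq> 0} \<subseteq> I n" using assms(2) by blast
  thus "finite {i \<in> UNIV. F i $ n \<noteq> 0}" using assms(1) by (rule finite_subset)
  show "S $ n = (\<Sum>i | i \<in> UNIV \<and> F i $ n \<noteq> 0. F i $ n)"
    unfolding assms(3) by (rule sum.mono_neutral_right) (use assms(1) sub in auto)
qed

text \<open>
  Evaluation at \<open>t = x\<close>. The sum stops at \<open>n\<close>, which is exact for series whose coefficient of \<open>t^m\<close> is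
  divisible by \<open>q^m\<close>; both series to which it is applied have this property.
\<close>

definition substitute_x :: "rat fps fps fps \<Rightarrow> rat fps fps" where
  "substitute_x f = Abs_fps (\<lambda>n. \<Sum>m\<le>n. (f $ m * xvar ^ m) $ n)"

lemma two_length_le_sum_list: "\<forall>p\<in>set ls. 2 \<le> p \<Longrightarrow> 2 * length ls \<le> sum_list (ls :: nat list)"
  by (induction ls) auto

lemma kr2_eq_0:
  assumes "n < m"
  shows "kr2 n m = 0"
proof -
  have empty: "{ls \<in> KR 2. length ls = m \<and> sum_list ls = n} = {}"
    using assms two_length_le_sum_list by (force simp: KR_def)
  have "of_nat (kr2 n m) = (0 :: rat fps)"
    unfolding kr2_eq_coefficient list_gf_nth empty by simp
  thus ?thesis by simp
qed

lemma of_nat_fps_mult_nth: "((of_nat k * f) :: 'a :: comm_semiring_1 fps) $ n = of_nat k * f $ n"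
  by (simp add: fps_of_nat[symmetric])

lemma has_sum_kr2:
  "((\<lambda>(n, m). of_nat (kr2 n m) * qvar ^ n * xvar ^ m) has_sum substitute_x (list_gf (KR 2))) UNIV"
proof (rule has_sum_fps_finite_support)
  fix n :: nat
  have coeff: "(of_nat (kr2 k m) * qvar ^ k * xvar ^ m) $ n
      = (if k = n then of_nat (kr2 n m) * fps_X ^ m else 0)" for k m
    by (simp add: mult.assoc of_nat_fps_mult_nth qvar_def xvar_def fps_X_power_mult_nth
        fps_const_power)
  have gf_coeff: "(list_gf (KR 2) $ m * xvar ^ m) $ n = of_nat (kr2 n m) * fps_X ^ m" for m
    by (simp add: xvar_def fps_const_power kr2_eq_coefficient)
  show "finite (Pair n ` {..n})" by simp
  show "(case i of (k, m) \<Rightarrow> of_nat (kr2 k m) * qvar ^ k * xvar ^ m) $ n = 0"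
    if "i \<notin> Pair n ` {..n}" for i
    using that by (cases i) (auto simp: coeff kr2_eq_0 image_iff)
  show "substitute_x (list_gf (KR 2)) $ n
      = (\<Sum>i\<in>Pair n ` {..n}. (case i of (k, m) \<Rightarrow> of_nat (kr2 k m) * qvar ^ k * xvar ^ m) $ n)"
    by (simp add: substitute_x_def sum.reindex inj_on_def coeff gf_coeff)
qed

lemma summand_eq_KR_term:
  "qvar ^ (3 * b^2 + 3 * b + a^2 + a + 3 * a * b) * xvar ^ (2 * b + a) / q_denominator a b
     = KR_term 1 3 a b * xvar ^ (a + 2 * b)"
proof -
  have "qvar ^ (3 * b^2 + 3 * b + a^2 + a + 3 * a * b)
      = KR_term 1 3 a b * q_denominator a b"
    unfolding KR_term_mult_denominator by (simp add: algebra_simps)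
  thus ?thesis
    by (subst divide_eq_iff_constant_term_one[OF q_denominator_constant_term])
      (simp add: algebra_simps)
qed

lemma has_sum_KR_term:
  "((\<lambda>(a, b). KR_term 1 3 a b * xvar ^ (a + 2 * b)) has_sum substitute_x (KR_series 1 3)) UNIV"
proof (rule has_sum_fps_finite_support)
  fix n :: nat
  let ?I = "{(a, b). a + 2 * b \<le> n}"
  show fin: "finite ?I"
    by (rule finite_subset[of _ "{..n} \<times> {..n}"]) auto
  show "(case i of (a, b) \<Rightarrow> KR_term 1 3 a b * xvar ^ (a + 2 * b)) $ n = 0" if i: "i \<notin> ?I" for i
  proof (cases i)
    case (Pair a b)
    have "KR_term 1 3 a b = qvar ^ (a + 2 * b) * KR_term 0 1 a b"
      using KR_term_shift[of 0 1 1 2] by (simp add: numeral_3_eq_3)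
    thus ?thesis
      using i Pair by (simp add: mult.assoc qvar_def fps_X_power_mult_nth)
  qed
  \<comment> \<open>Grouping the index pairs by the exponent of \<open>x\<close>.\<close>
  have "substitute_x (KR_series 1 3) $ n
      = (\<Sum>m\<le>n. \<Sum>(a, b)\<in>weight_fibre m. (KR_term 1 3 a b * xvar ^ (a + 2 * b)) $ n)"
    by (auto simp: substitute_x_def KR_series_def sum_distrib_right fps_sum_nth case_prod_beta
        weight_fibre_def intro!: sum.cong)
  also have "\<dots> = (\<Sum>m\<le>n. \<Sum>i\<in>{i \<in> ?I. fst i + 2 * snd i = m}.
      (case i of (a, b) \<Rightarrow> KR_term 1 3 a b * xvar ^ (a + 2 * b)) $ n)"
    by (intro sum.cong) (auto simp: weight_fibre_def)
  also have "\<dots> = (\<Sum>i\<in>?I. (case i of (a, b) \<Rightarrow> KR_term 1 3 a b * xvar ^ (a + 2 * b)) $ n)"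
    by (rule sum.group) (use fin in auto)
  finally show "substitute_x (KR_series 1 3) $ n
      = (\<Sum>i\<in>?I. (case i of (a, b) \<Rightarrow> KR_term 1 3 a b * xvar ^ (a + 2 * b)) $ n)" .
qed

theorem theorem8:
  shows "(\<lambda>(n, m). of_nat (kr2 n m) * qvar ^ n * xvar ^ m) summable_on (UNIV :: (nat \<times> nat) set) \<and>
    (\<lambda>(n1, n2). qvar ^ (3 * n2^2 + 3 * n2 + n1^2 + n1 + 3 * n1 * n2) * xvar ^ (2 * n2 + n1)
        / (qpochhammer qvar qvar n1 * qpochhammer (qvar ^ 3) (qvar ^ 3) n2))
      summable_on (UNIV :: (nat \<times> nat) set) \<and>
    (\<Sum>\<^sub>\<infinity>(n, m)\<in>UNIV. of_nat (kr2 n m) * qvar ^ n * xvar ^ m) =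
    (\<Sum>\<^sub>\<infinity>(n1, n2)\<in>UNIV.
        qvar ^ (3 * n2^2 + 3 * n2 + n1^2 + n1 + 3 * n1 * n2) * xvar ^ (2 * n2 + n1)
        / (qpochhammer qvar qvar n1 * qpochhammer (qvar ^ 3) (qvar ^ 3) n2))"
  unfolding summand_eq_KR_term
  using has_sum_kr2 has_sum_KR_term
  unfolding list_gf_KR2 by (auto simp: infsumI summable_on_def)

end
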